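(* For every integer $k\ge4$, $$\tau(k)\ge\left\lfloor\frac{k}{2}\right\rfloor.$$ Moreover, for every fixed integer $t\ge0$, $$\frac{\bigl|\{T\in\mathcal T_k\mid \sigma_t^{-1}(\sigma_t(T))=\{T\}\}\bigr|}{|\mathcal T_k|}\longrightarrow0\qquad(k\to\infty).$$
   Context: Let $\mathcal T_k$ be the set of isomorphism classes of (unlabeled, unrooted) trees on $k$ vertices. For $S\in\mathcal T_k$ and $F\subseteq E(S)$, the component type of $F$ is the integer partition of $k$ formed by the orders (numbers of vertices) of the connected components of the spanning forest $(V(S),F)$. For a partition $\mu\vdash k$, $N_\mu(S)$ is the number of edge sets $F\subseteq E(S)$ of component type $\mu$, and $\ell(\mu)$ is the number of parts of $\mu$. For each nonnegative integer $t$, let $$\mathcal P_{k,t}=\{\mu\vdash k\mid \ell(\mu)\ge k-t\},$$ and define $$\sigma_t\colon\mathcal T_k\to\mathbb Z_{\ge0}^{\mathcal P_{k,t}},\qquad \sigma_t(S)=\bigl(N_\mu(S)\bigr)_{\mu\in\mathcal P_{k,t}}.$$ Let $$\tau(k)=\min\bigl(\{t\in\mathbb Z_{\ge0}\mid \sigma_t\text{ is injective on }\mathcal T_k\}\cup\{\infty\}\bigr).$$ *)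

theory Defs
  imports
    Complex_Main
    "HOL-Library.Multiset"
    "HOL-Library.FuncSet"
    "HOL-Library.Extended_Nat"
begin

section \<open>Finite simple graphs and trees\<close>

text \<open>A simple graph is a vertex set \<open>V\<close> with a set \<open>E\<close> of two-element subsets of \<open>V\<close>.\<close>

definition simple_graph :: "'a set \<Rightarrow> 'a set set \<Rightarrow> bool" where
  "simple_graph V E \<longleftrightarrow> finite V \<and> (\<forall>e\<in>E. e \<subseteq> V \<and> card e = 2)"

definition adj :: "'a set set \<Rightarrow> 'a rel" where
  "adj E = {(u, v). {u, v} \<in> E}"

definition connected_graph :: "'a set \<Rightarrow> 'a set set \<Rightarrow> bool" where
  "connected_graph V E \<longleftrightarrow> V \<noteq> {} \<and> (\<forall>u\<in>V. \<forall>v\<in>V. (u, v) \<in> (adj E)\<^sup>*)"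

definition is_cycle :: "'a set set \<Rightarrow> 'a list \<Rightarrow> bool" where
  "is_cycle E p \<longleftrightarrow> 3 \<le> length p \<and> distinct p \<and>
     (\<forall>i<length p. {p ! i, p ! (Suc i mod length p)} \<in> E)"

definition is_tree :: "'a set \<Rightarrow> 'a set set \<Rightarrow> bool" where
  "is_tree V E \<longleftrightarrow> simple_graph V E \<and> connected_graph V E \<and> (\<nexists>p. is_cycle E p)"

definition graph_isomorphic :: "'a set \<Rightarrow> 'a set set \<Rightarrow> 'b set \<Rightarrow> 'b set set \<Rightarrow> bool" where
  "graph_isomorphic V E V' E' \<longleftrightarrow> (\<exists>f. bij_betw f V V' \<and> (\<lambda>e. f ` e) ` E = E')"

text \<open>Every finite graph on \<open>k\<close> vertices is isomorphic to one with vertex set \<open>{..<k}\<close>, so the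
  isomorphism classes of trees on \<open>k\<close> vertices are the classes of the trees with that vertex set.\<close>

definition labelled_trees :: "nat \<Rightarrow> nat set set set" where
  "labelled_trees k = {E. is_tree {..<k} E}"

definition tree_iso :: "nat \<Rightarrow> nat set set rel" where
  "tree_iso k = {(E, E'). E \<in> labelled_trees k \<and> E' \<in> labelled_trees k \<and>
                          graph_isomorphic {..<k} E {..<k} E'}"

definition trees :: "nat \<Rightarrow> nat set set set set" where
  "trees k = labelled_trees k // tree_iso k"

section \<open>Component types\<close>

text \<open>For \<open>F\<close> a set of edges on \<open>V\<close>, the relation \<open>(adj F)\<^sup>*\<close> does not leave \<open>V\<close>, so its classes
  of elements of \<open>V\<close> are the vertex sets of the components of \<open>(V, F)\<close>.\<close>

definition components :: "'a set \<Rightarrow> 'a set set \<Rightarrow> 'a set set" where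
  "components V F = V // (adj F)\<^sup>*"

definition component_type :: "'a set \<Rightarrow> 'a set set \<Rightarrow> nat multiset" where
  "component_type V F = image_mset card (mset_set (components V F))"

definition num_edge_sets :: "'a set \<Rightarrow> 'a set set \<Rightarrow> nat multiset \<Rightarrow> nat" where
  "num_edge_sets V E \<mu> = card {F. F \<subseteq> E \<and> component_type V F = \<mu>}"

text \<open>Integer partitions are multisets of positive natural numbers.\<close>

definition partitions :: "nat \<Rightarrow> nat multiset set" where
  "partitions k = {\<mu>. 0 \<notin># \<mu> \<and> sum_mset \<mu> = k}"

definition large_partitions :: "nat \<Rightarrow> nat \<Rightarrow> nat multiset set" where
  "large_partitions k t = {\<mu> \<in> partitions k. int (size \<mu>) \<ge> int k - int t}"

text \<open>The counts depend only on the isomorphism class (\<open>num_edge_sets_respects\<close> below), so the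
  image in the next definition is a singleton for every class of trees.\<close>

definition tree_count :: "nat \<Rightarrow> nat set set set \<Rightarrow> nat multiset \<Rightarrow> nat" where
  "tree_count k S \<mu> = the_elem ((\<lambda>E. num_edge_sets {..<k} E \<mu>) ` S)"

definition signature :: "nat \<Rightarrow> nat \<Rightarrow> nat set set set \<Rightarrow> (nat multiset \<Rightarrow> nat)" where
  "signature k t S = restrict (tree_count k S) (large_partitions k t)"

definition tau :: "nat \<Rightarrow> enat" where
  "tau k = (LEAST x. x \<in> enat ` {t. inj_on (signature k t) (trees k)} \<union> {\<infinity>})"

section \<open>Well-definedness\<close>

lemma finite_labelled_trees: "finite (labelled_trees k)"
  by (rule finite_subset[of _ "Pow (Pow {..<k})"])
     (auto simp: labelled_trees_def is_tree_def simple_graph_def)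

lemma labelled_trees_subset: "E \<in> labelled_trees k \<Longrightarrow> \<forall>e\<in>E. e \<subseteq> {..<k}"
  by (simp add: labelled_trees_def is_tree_def simple_graph_def)

lemma graph_isomorphic_refl: "graph_isomorphic V E V E"
  unfolding graph_isomorphic_def by (rule exI[of _ id]) auto

lemma graph_isomorphic_sym:
  assumes "\<forall>e\<in>E. e \<subseteq> V" "graph_isomorphic V E V' E'"
  shows "graph_isomorphic V' E' V E"
proof -
  from assms obtain f where f: "bij_betw f V V'" "E' = (\<lambda>e. f ` e) ` E"
    by (auto simp: graph_isomorphic_def)
  have "inv_into V f ` f ` e = e" if "e \<in> E" for e
    using assms(1) f(1) that by (intro inv_into_image_cancel) (auto simp: bij_betw_def)
  hence "(\<lambda>e. inv_into V f ` e) ` E' = E"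
    unfolding f(2) by (force simp: image_image)
  with bij_betw_inv_into[OF f(1)] show ?thesis
    unfolding graph_isomorphic_def by blast
qed

lemma graph_isomorphic_trans:
  assumes "graph_isomorphic V E V' E'" "graph_isomorphic V' E' V'' E''"
  shows "graph_isomorphic V E V'' E''"
proof -
  from assms obtain f g where "bij_betw f V V'" "E' = (\<lambda>e. f ` e) ` E"
    "bij_betw g V' V''" "E'' = (\<lambda>e. g ` e) ` E'"
    by (auto simp: graph_isomorphic_def)
  thus ?thesis unfolding graph_isomorphic_def
    by (intro exI[of _ "g \<circ> f"]) (auto intro: bij_betw_trans simp: image_image image_comp)
qed

lemma equiv_tree_iso: "equiv (labelled_trees k) (tree_iso k)"
proof (rule equivI)
  show "tree_iso k \<subseteq> labelled_trees k \<times> labelled_trees k"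
    by (auto simp: tree_iso_def)
  show "refl_on (labelled_trees k) (tree_iso k)"
    by (auto simp: refl_on_def tree_iso_def graph_isomorphic_refl)
  show "sym (tree_iso k)"
    by (rule symI) (auto simp: tree_iso_def dest: labelled_trees_subset intro: graph_isomorphic_sym)
  show "trans (tree_iso k)"
    by (rule transI) (auto simp: tree_iso_def intro: graph_isomorphic_trans)
qed

lemma finite_trees: "finite (trees k)"
  unfolding trees_def
  by (rule finite_quotient[OF finite_labelled_trees equiv_type[OF equiv_tree_iso]])

lemma rtrancl_adj_image:
  assumes "(u, v) \<in> (adj F)\<^sup>*"
  shows "(f u, f v) \<in> (adj ((\<lambda>e. f ` e) ` F))\<^sup>*"
  using assms
proof induction
  case (step y z)
  have "(f y, f z) \<in> adj ((\<lambda>e. f ` e) ` F)"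
    using step(2) unfolding adj_def by (auto intro!: image_eqI[of _ _ "{y, z}"])
  with step.IH show ?case by (rule rtrancl_into_rtrancl)
qed auto

lemma rtrancl_adj_stays:
  assumes "\<forall>e\<in>F. e \<subseteq> V" "(u, v) \<in> (adj F)\<^sup>*" "u \<in> V"
  shows "v \<in> V"
  using assms(2,3) by induction (use assms(1) in \<open>auto simp: adj_def\<close>)

lemma components_subset:
  assumes "\<forall>e\<in>F. e \<subseteq> V" "C \<in> components V F"
  shows "C \<subseteq> V" "C \<noteq> {}"
proof -
  from assms(2) obtain u where "u \<in> V" "C = (adj F)\<^sup>* `` {u}"
    by (auto simp: components_def elim: quotientE)
  thus "C \<subseteq> V" "C \<noteq> {}" by (auto dest: rtrancl_adj_stays[OF assms(1)])
qed

lemma component_type_image: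
  assumes f: "bij_betw f V V'" and F: "\<forall>e\<in>F. e \<subseteq> V"
  shows "component_type V' ((\<lambda>e. f ` e) ` F) = component_type V F"
proof -
  let ?F' = "(\<lambda>e. f ` e) ` F"
  have inj: "inj_on f V" and V': "V' = f ` V" using f by (auto simp: bij_betw_def)
  have F_eq: "(\<lambda>e. inv_into V f ` e) ` ?F' = F"
  proof -
    have "inv_into V f ` f ` e = e" if "e \<in> F" for e
      using F inj that by (intro inv_into_image_cancel) auto
    thus ?thesis by (force simp: image_image)
  qed
  have F': "\<forall>e\<in>?F'. e \<subseteq> V'" using F V' by auto
  have cls: "(adj ?F')\<^sup>* `` {f u} = f ` ((adj F)\<^sup>* `` {u})" if u: "u \<in> V" for u
  proof (intro set_eqI iffI)
    fix w assume "w \<in> f ` ((adj F)\<^sup>* `` {u})"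
    thus "w \<in> (adj ?F')\<^sup>* `` {f u}" by (auto intro: rtrancl_adj_image)
  next
    fix w assume w: "w \<in> (adj ?F')\<^sup>* `` {f u}"
    have wV: "w \<in> V'" using rtrancl_adj_stays[OF F', of "f u" w] w u V' by auto
    have "(inv_into V f (f u), inv_into V f w) \<in> (adj F)\<^sup>*"
      using rtrancl_adj_image[of "f u" w ?F' "inv_into V f"] w unfolding F_eq by auto
    hence "(u, inv_into V f w) \<in> (adj F)\<^sup>*" using inj u by simp
    moreover have "f (inv_into V f w) = w" using wV V' by (simp add: f_inv_into_f)
    ultimately show "w \<in> f ` ((adj F)\<^sup>* `` {u})" by (force simp: image_iff)
  qed
  have sub: "C \<subseteq> V" if "C \<in> components V F" for C
    using components_subset(1)[OF F that] .
  have comps: "components V' ?F' = (\<lambda>C. f ` C) ` components V F"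
    unfolding components_def quotient_def V' using cls by auto
  have injC: "inj_on (\<lambda>C. f ` C) (components V F)"
    using sub by (intro inj_onI) (metis inj inj_on_image_eq_iff)
  have "component_type V' ?F' = image_mset card (image_mset (\<lambda>C. f ` C) (mset_set (components V F)))"
    unfolding component_type_def comps using image_mset_mset_set[OF injC] by simp
  also have "\<dots> = component_type V F"
  proof (cases "finite (components V F)")
    case True
    thus ?thesis unfolding component_type_def
      by (auto intro!: image_mset_cong card_image inj_on_subset[OF inj sub]
               simp: multiset.map_comp)
  qed (simp add: component_type_def)
  finally show ?thesis .
qed

lemma num_edge_sets_isomorphic:
  assumes "\<forall>e\<in>E. e \<subseteq> V" "graph_isomorphic V E V' E'"
  shows "num_edge_sets V E \<mu> = num_edge_sets V' E' \<mu>"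
proof -
  from assms obtain f where f: "bij_betw f V V'" "E' = (\<lambda>e. f ` e) ` E"
    by (auto simp: graph_isomorphic_def)
  let ?g = "\<lambda>F. (\<lambda>e. f ` e) ` F"
  have injE: "inj_on (\<lambda>e. f ` e) E"
    using assms(1) f(1) by (intro inj_onI) (metis bij_betw_def inj_on_image_eq_iff)
  have type: "component_type V' (?g F) = component_type V F" if "F \<subseteq> E" for F
    using component_type_image[OF f(1)] assms(1) that by blast
  have "{F. F \<subseteq> E' \<and> component_type V' F = \<mu>} = ?g ` {F. F \<subseteq> E \<and> component_type V F = \<mu>}"
    unfolding f(2) by (auto simp: subset_image_iff type)
  moreover have "inj_on ?g {F. F \<subseteq> E \<and> component_type V F = \<mu>}"
    using injE by (intro inj_onI) (auto simp: inj_on_image_eq_iff)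
  ultimately show ?thesis unfolding num_edge_sets_def by (simp add: card_image)
qed

lemma num_edge_sets_respects: "(\<lambda>E. num_edge_sets {..<k} E \<mu>) respects tree_iso k"
  by (auto simp: congruent_def tree_iso_def intro!: num_edge_sets_isomorphic
           dest: labelled_trees_subset)

lemma tree_count_class:
  assumes "E \<in> labelled_trees k"
  shows "tree_count k (tree_iso k `` {E}) \<mu> = num_edge_sets {..<k} E \<mu>"
proof -
  have "(\<lambda>E. num_edge_sets {..<k} E \<mu>) ` (tree_iso k `` {E}) = {num_edge_sets {..<k} E \<mu>}"
    using num_edge_sets_respects[of k \<mu>] equiv_class_self[OF equiv_tree_iso assms]
    by (fastforce simp: congruent_def)
  thus ?thesis by (simp add: tree_count_def)
qed

lemma component_type_in_partitions:
  assumes "finite V" "\<forall>e\<in>F. e \<subseteq> V"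
  shows "component_type V F \<in> partitions (card V)"
proof -
  have stay: "C \<subseteq> V \<and> C \<noteq> {}" if "C \<in> components V F" for C
    using components_subset[OF assms(2) that] by simp
  have fin: "finite (components V F)"
    using stay assms(1) by (auto intro!: finite_subset[of "components V F" "Pow V"])
  have finC: "finite C" if "C \<in> components V F" for C
    using stay[OF that] assms(1) finite_subset by blast
  have "sym (adj F)" by (auto simp: sym_def adj_def insert_commute)
  hence eq: "equiv UNIV ((adj F)\<^sup>*)"
    by (intro equivI) (auto intro: refl_rtrancl sym_rtrancl trans_rtrancl)
  have disj: "C \<inter> D = {}" if "C \<in> components V F" "D \<in> components V F" "C \<noteq> D" for C D
  proof -
    have "C \<in> UNIV // (adj F)\<^sup>*" "D \<in> UNIV // (adj F)\<^sup>*"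
      using that by (auto simp: components_def quotient_def)
    with quotient_disj[OF eq] that(3) show ?thesis by blast
  qed
  have un: "\<Union> (components V F) = V"
  proof
    show "\<Union> (components V F) \<subseteq> V" using stay by blast
    show "V \<subseteq> \<Union> (components V F)" by (auto simp: components_def quotient_def)
  qed
  have "card V = (\<Sum>C\<in>components V F. card C)"
    using card_Union_disjoint[of "components V F"] disj finC un
    by (auto simp: pairwise_def disjnt_def)
  moreover have "0 \<notin># component_type V F"
    using fin finC stay by (auto simp: component_type_def)
  ultimately show ?thesis
    by (simp add: partitions_def component_type_def sum_unfold_sum_mset)
qed

end

theory Submission
  imports Defs "HOL-Real_Asymp.Real_Asymp"
begin

text \<open>In a tree on \<open>k\<close> vertices a set of \<open>j\<close> edges has \<open>k - j\<close> components, so the signature of level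
  \<open>t\<close> sees only the edge sets with at most \<open>t\<close> edges (\<open>large_type_few_edges\<close>). Both halves of the
  theorem rest on this.

  For the lower bound on \<open>tau\<close>, put \<open>h = k div 2 - 1\<close>, take a path with \<open>k - 1\<close> vertices
  \<open>0, \<dots>, k - 2\<close> and hang one more leaf on vertex \<open>h\<close>, or on vertex \<open>h - 1\<close>. An edge set that omits
  the pendant edge occurs in both trees. Suppose that an edge set of size at most \<open>h\<close> contains the
  pendant edge; then it has at most \<open>h - 1\<close> edges on the path. For \<open>q = 1, \<dots>, h\<close> consider the
  window of the \<open>2 * q\<close> path vertices centred on the edge \<open>{h - 1, h}\<close>. The boundaries of these \<open>h\<close>
  windows are pairwise disjoint sets of path edges, so some window has a boundary that the edge set
  avoids. Reversing the order of the vertices in that window permutes all vertices and exchanges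
  \<open>h - 1\<close> with \<open>h\<close>; it carries the edge set to an edge set of the other tree with the same
  component type. With the smallest such window this is an involution (\<open>flip_spider\<close>), so the two
  trees have the same signature at every level up to \<open>h\<close>. They are not isomorphic, because the
  numbers of vertices within distance \<open>h\<close> of the branch vertex differ
  (\<open>spiders_not_isomorphic\<close>).

  For the limit, a tree that is alone in its fibre is determined by its signature, so it suffices
  that there are far fewer signatures than trees. A partition of \<open>k\<close> with at least \<open>k - t\<close>
  parts has bounded parts and boundedly many parts larger than one, so the number of coordinates of
  a signature is bounded in terms of \<open>t\<close>, and each coordinate is at most the number of sets of at
  most \<open>t\<close> edges. Hence the number of signatures grows polynomially in \<open>k\<close>
  (\<open>card_signatures_le\<close>). On the other hand every set of numbers from \<open>2\<close> to \<open>s\<close>, where \<open>s\<close> is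
  about the square root of \<open>k\<close>, can be prescribed, up to a shift by one, as the set of degrees above
  two of a tree on \<open>k\<close> vertices, so there are at least \<open>2 ^ (s - 1)\<close> trees
  (\<open>card_trees_ge\<close>).\<close>

section \<open>Trees and forests\<close>

lemma sym_rtrancl_adj: "(u, v) \<in> (adj F)\<^sup>* \<longleftrightarrow> (v, u) \<in> (adj F)\<^sup>*"
proof -
  have "sym ((adj F)\<^sup>*)"
    by (rule sym_rtrancl) (auto simp: sym_def adj_def insert_commute)
  thus ?thesis by (auto dest: symD)
qed

lemma adj_mono: "F \<subseteq> G \<Longrightarrow> adj F \<subseteq> adj G"
  by (auto simp: adj_def)

lemma is_cycle_mono: "is_cycle F p \<Longrightarrow> F \<subseteq> G \<Longrightarrow> is_cycle G p"
  unfolding is_cycle_def by blast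

text \<open>This is how acyclicity gets used below: a vertex with a single neighbour lies on no cycle.\<close>

lemma cycle_vertex_neighbours:
  assumes "is_cycle E p" "w \<in> set p"
  obtains x y where "x \<noteq> y" "{w, x} \<in> E" "{w, y} \<in> E"
proof -
  let ?n = "length p"
  from assms have n: "3 \<le> ?n" and d: "distinct p"
    and e: "\<And>i. i < ?n \<Longrightarrow> {p ! i, p ! (Suc i mod ?n)} \<in> E"
    by (auto simp: is_cycle_def)
  from assms(2) obtain i where i: "i < ?n" "w = p ! i" by (auto simp: in_set_conv_nth)
  define j where "j = (if i = 0 then ?n - 1 else i - 1)"
  have j: "j < ?n" "Suc j mod ?n = i" using i n by (auto simp: j_def)
  have s: "Suc i mod ?n < ?n" using n by (intro mod_less_divisor) linarith
  have "Suc i mod ?n \<noteq> j"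
  proof (cases "Suc i = ?n")
    case True thus ?thesis using n by (auto simp: j_def)
  next
    case False hence "Suc i mod ?n = Suc i" using i by simp
    thus ?thesis using n by (auto simp: j_def)
  qed
  hence "p ! (Suc i mod ?n) \<noteq> p ! j" using d s j by (simp add: nth_eq_iff_index_eq)
  moreover have "{w, p ! (Suc i mod ?n)} \<in> E" using e[OF i(1)] i by simp
  moreover have "{w, p ! j} \<in> E" using e[OF j(1)] i j by (simp add: insert_commute)
  ultimately show thesis by (rule that)
qed

text \<open>All concrete trees in this development are grown by this step. The new vertex has only one
  neighbour, so no cycle passes through it.\<close>

lemma is_tree_attach_leaf:
  assumes T: "is_tree V E" and v: "v \<in> V" and w: "w \<notin> V"
  shows "is_tree (insert w V) (insert {v, w} E)"
proof -
  let ?E = "insert {v, w} E"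
  from T have sg: "simple_graph V E" and con: "connected_graph V E" and ac: "\<nexists>p. is_cycle E p"
    by (auto simp: is_tree_def)
  have wE: "w \<notin> e" if "e \<in> E" for e using sg w that by (auto simp: simple_graph_def)
  have vw: "v \<noteq> w" using v w by auto
  have "simple_graph (insert w V) ?E"
    using sg v vw by (auto simp: simple_graph_def)
  moreover have "connected_graph (insert w V) ?E"
  proof -
    have "(adj E)\<^sup>* \<subseteq> (adj ?E)\<^sup>*" by (intro rtrancl_mono adj_mono) auto
    hence *: "(v, u) \<in> (adj ?E)\<^sup>*" if "u \<in> V" for u
      using con v that by (auto simp: connected_graph_def)
    have "(v, w) \<in> (adj ?E)\<^sup>*" by (rule r_into_rtrancl) (simp add: adj_def)
    with * have "(v, u) \<in> (adj ?E)\<^sup>*" if "u \<in> insert w V" for u using that by auto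
    thus ?thesis unfolding connected_graph_def
      by (meson insert_not_empty rtrancl_trans sym_rtrancl_adj)
  qed
  moreover have "\<nexists>p. is_cycle ?E p"
  proof
    assume "\<exists>p. is_cycle ?E p"
    then obtain p where p: "is_cycle ?E p" by blast
    show False
    proof (cases "w \<in> set p")
      case True
      from cycle_vertex_neighbours[OF p this] obtain x y
        where "x \<noteq> y" "{w, x} \<in> ?E" "{w, y} \<in> ?E" .
      thus False using wE vw by (auto simp: doubleton_eq_iff)
    next
      case False
      have "is_cycle E p" unfolding is_cycle_def
      proof (intro conjI allI impI)
        fix i assume i: "i < length p"
        hence "Suc i mod length p < length p" by (intro mod_less_divisor) linarith
        hence "w \<noteq> p ! i" "w \<noteq> p ! (Suc i mod length p)" using False i by (metis nth_mem)+
        moreover have "{p ! i, p ! (Suc i mod length p)} \<in> ?E" using p i by (auto simp: is_cycle_def)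
        ultimately show "{p ! i, p ! (Suc i mod length p)} \<in> E" by auto
      qed (use p in \<open>auto simp: is_cycle_def\<close>)
      with ac show False by blast
    qed
  qed
  ultimately show ?thesis by (simp add: is_tree_def)
qed

lemma is_tree_single_vertex: "is_tree {v} {}"
proof -
  have "\<not> is_cycle {} p" for p :: "'a list"
  proof
    assume p: "is_cycle {} p"
    hence "p ! 0 \<in> set p" unfolding is_cycle_def by (intro nth_mem) linarith
    from cycle_vertex_neighbours[OF p this] show False by blast
  qed
  thus ?thesis by (simp add: is_tree_def simple_graph_def connected_graph_def)
qed

text \<open>A walk that returns to one of its vertices can be cut back to the first visit, so the induction
  along the walk can keep the vertices distinct.\<close>

lemma reachable_by_distinct_path:
  assumes "(u, v) \<in> (adj F)\<^sup>*"
  obtains p where "p \<noteq> []" "hd p = u" "last p = v" "distinct p"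
    "\<forall>i. Suc i < length p \<longrightarrow> {p ! i, p ! Suc i} \<in> F"
proof -
  have "\<exists>p. p \<noteq> [] \<and> hd p = u \<and> last p = v \<and> distinct p \<and>
          (\<forall>i. Suc i < length p \<longrightarrow> {p ! i, p ! Suc i} \<in> F)"
    using assms
  proof induction
    case base
    show ?case by (intro exI[of _ "[u]"]) auto
  next
    case (step y z)
    then obtain p where p: "p \<noteq> []" "hd p = u" "last p = y" "distinct p"
      "\<forall>i. Suc i < length p \<longrightarrow> {p ! i, p ! Suc i} \<in> F" by blast
    show ?case
    proof (cases "z \<in> set p")
      case True
      then obtain xs ys where s: "p = xs @ z # ys" by (auto simp: in_set_conv_decomp)
      have "{(xs @ [z]) ! i, (xs @ [z]) ! Suc i} \<in> F" if "Suc i < length (xs @ [z])" for i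
        using p(5)[rule_format, of i] that unfolding s
        by (auto simp: nth_append less_Suc_eq split: if_splits)
      thus ?thesis using p by (intro exI[of _ "xs @ [z]"]) (auto simp: s hd_append)
    next
      case False
      have "{(p @ [z]) ! i, (p @ [z]) ! Suc i} \<in> F" if "Suc i < length (p @ [z])" for i
      proof (cases "Suc i < length p")
        case True
        thus ?thesis using p(5) by (auto simp: nth_append)
      next
        case False
        hence i: "i = length p - 1" "Suc i = length p" using that p(1) by auto
        have "p ! i = y" using p i by (simp add: last_conv_nth)
        thus ?thesis using step(2) i by (auto simp: nth_append adj_def)
      qed
      thus ?thesis using p False by (intro exI[of _ "p @ [z]"]) auto
    qed
  qed
  thus thesis using that by blast
qed

text \<open>A path in \<open>F\<close> from \<open>u\<close> to \<open>v\<close> would be closed to a cycle by the edge \<open>{u, v}\<close>.\<close>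

lemma acyclic_edge_separates:
  assumes "{u, v} \<notin> F" "u \<noteq> v" "\<nexists>p. is_cycle (insert {u, v} F) p"
  shows "(u, v) \<notin> (adj F)\<^sup>*"
proof
  assume "(u, v) \<in> (adj F)\<^sup>*"
  then obtain p where p: "p \<noteq> []" "hd p = u" "last p = v" "distinct p"
    "\<forall>i. Suc i < length p \<longrightarrow> {p ! i, p ! Suc i} \<in> F" by (rule reachable_by_distinct_path)
  have u: "p ! 0 = u" and v: "p ! (length p - 1) = v"
    using p by (simp_all add: hd_conv_nth last_conv_nth)
  have "length p \<noteq> 0" using p(1) by simp
  moreover have "length p \<noteq> 1"
  proof
    assume "length p = 1"
    hence "u = v" using u v by simp
    with assms(2) show False ..
  qed
  moreover have "length p \<noteq> 2"
  proof
    assume "length p = 2"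
    hence "{u, v} \<in> F" using p(5)[rule_format, of 0] u v by simp
    with assms(1) show False ..
  qed
  ultimately have n: "3 \<le> length p" by linarith
  have "{p ! i, p ! (Suc i mod length p)} \<in> insert {u, v} F" if i: "i < length p" for i
  proof (cases "Suc i < length p")
    case True
    thus ?thesis using p(5) by simp
  next
    case False
    hence "Suc i = length p" using i by linarith
    hence "i = length p - 1" "Suc i mod length p = 0" by simp_all
    thus ?thesis using u v by (simp add: insert_commute)
  qed
  hence "is_cycle (insert {u, v} F) p" using n p(4) by (simp add: is_cycle_def)
  with assms(3) show False by blast
qed

lemma finite_components: "finite V \<Longrightarrow> finite (components V F)"
  by (simp add: components_def quotient_def)

text \<open>Enlarging components to those of the larger edge set maps the old components onto the new ones,
  and the components of \<open>u\<close> and of \<open>v\<close>, which are different, receive the same image.\<close>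

lemma card_components_insert_edge:
  assumes V: "finite V" "u \<in> V" "v \<in> V" and sep: "(u, v) \<notin> (adj F)\<^sup>*"
  shows "card (components V (insert {u, v} F)) < card (components V F)"
proof -
  let ?r = "(adj F)\<^sup>*" and ?s = "(adj (insert {u, v} F))\<^sup>*"
  let ?g = "\<lambda>C. ?s `` C"
  have rs: "?r \<subseteq> ?s" by (intro rtrancl_mono adj_mono) auto
  have g: "?g (?r `` {x}) = ?s `` {x}" for x
    using rs by (auto intro: rtrancl_trans)
  have uv: "(u, v) \<in> ?s" by (rule r_into_rtrancl) (simp add: adj_def)
  hence same: "?s `` {u} = ?s `` {v}"
    using sym_rtrancl_adj[of u v] by (auto intro: rtrancl_trans)
  have ne: "?r `` {u} \<noteq> ?r `` {v}" using sep by auto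
  \<comment> \<open>The component of \<open>v\<close> already supplies the merged component, so that of \<open>u\<close> can be left out.\<close>
  have "components V (insert {u, v} F) = ?g ` (components V F - {?r `` {u}})"
  proof (intro set_eqI iffI)
    fix C assume "C \<in> components V (insert {u, v} F)"
    then obtain x where x: "x \<in> V" "C = ?s `` {x}" by (auto simp: components_def quotient_def)
    show "C \<in> ?g ` (components V F - {?r `` {u}})"
    proof (cases "?r `` {x} = ?r `` {u}")
      case True
      hence "C = ?g (?r `` {v})" using x g same by metis
      thus ?thesis using ne V by (auto simp: components_def quotient_def)
    next
      case False
      thus ?thesis using x g[of x] by (auto simp: components_def quotient_def)
    qed
  next
    fix C assume "C \<in> ?g ` (components V F - {?r `` {u}})"
    thus "C \<in> components V (insert {u, v} F)"
      using g by (auto simp: components_def quotient_def)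
  qed
  also have "card \<dots> \<le> card (components V F - {?r `` {u}})"
    using V by (intro card_image_le) (simp add: finite_components)
  also have "\<dots> < card (components V F)"
    using V by (intro psubset_card_mono) (auto simp: finite_components components_def quotient_def)
  finally show ?thesis .
qed

text \<open>When a forest is built edge by edge, every new edge joins two different components, so it lowers
  their number, which is \<open>card V\<close> at the start. This turns "many components" into "few edges".\<close>

lemma forest_components_plus_edges:
  assumes "simple_graph V E" "\<nexists>p. is_cycle E p"
  shows "card (components V E) + card E \<le> card V"
proof -
  have V: "finite V" and "finite E"
    using assms(1) finite_subset[of E "Pow V"] by (auto simp: simple_graph_def)
  from this(2) show ?thesis using assms
  proof (induction E)
    case empty
    have "components V {} = (\<lambda>x. {x}) ` V" by (auto simp: components_def quotient_def adj_def)
    thus ?case by (simp add: card_image)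
  next
    case (insert e F)
    from insert.prems(1) have e: "card e = 2" "e \<subseteq> V" by (auto simp: simple_graph_def)
    then obtain u v where uv: "e = {u, v}" "u \<noteq> v" by (auto simp: card_2_iff)
    have "simple_graph V F" using insert.prems(1) by (simp add: simple_graph_def)
    moreover have "\<nexists>p. is_cycle F p" using insert.prems(2) by (auto simp: is_cycle_def)
    ultimately have IH: "card (components V F) + card F \<le> card V" by (rule insert.IH)
    have "(u, v) \<notin> (adj F)\<^sup>*"
      using insert uv by (intro acyclic_edge_separates) auto
    hence "card (components V (insert e F)) < card (components V F)"
      unfolding uv(1) using V e uv by (intro card_components_insert_edge) auto
    thus ?case using IH insert.hyps by simp
  qed
qed

lemma large_type_few_edges:
  assumes "is_tree V E" "F \<subseteq> E" "component_type V F \<in> large_partitions (card V) t"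
  shows "card F \<le> t"
proof -
  have sg: "simple_graph V F" using assms(1,2) by (auto simp: is_tree_def simple_graph_def)
  have "\<nexists>p. is_cycle F p" using assms(1,2) is_cycle_mono unfolding is_tree_def by blast
  with sg have "card (components V F) + card F \<le> card V" by (rule forest_components_plus_edges)
  moreover have "size (component_type V F) = card (components V F)"
    by (simp add: component_type_def)
  ultimately show ?thesis using assms(3) by (simp add: large_partitions_def)
qed

text \<open>Neighbourhoods are carried along by an isomorphism, although the vertex map is injective on \<open>V\<close>
  only. Degrees and distances are therefore isomorphism invariants.\<close>

lemma adj_isomorphic:
  assumes "simple_graph V E" "bij_betw f V V'" "v \<in> V"
  shows "adj ((\<lambda>e. f ` e) ` E) `` {f v} = f ` (adj E `` {v})"
proof (intro set_eqI iffI)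
  fix y assume "y \<in> adj ((\<lambda>e. f ` e) ` E) `` {f v}"
  then obtain e where e: "e \<in> E" "f ` e = {f v, y}" by (auto simp: adj_def)
  from assms(1) e(1) have eV: "e \<subseteq> V" "card e = 2" by (auto simp: simple_graph_def)
  have inj: "inj_on f V" using assms(2) by (simp add: bij_betw_def)
  have "f v \<in> f ` e" using e by auto
  hence v: "v \<in> e" using inj eV assms(3) by (simp add: inj_on_image_mem_iff)
  then obtain x where x: "e = {v, x}" "x \<noteq> v" using eV by (auto simp: card_2_iff)
  hence "f x \<noteq> f v" using inj eV assms(3) by (auto simp: inj_on_eq_iff)
  hence "y = f x" using e x by (auto simp: doubleton_eq_iff)
  thus "y \<in> f ` (adj E `` {v})" using e x by (auto simp: adj_def)
next
  fix y assume "y \<in> f ` (adj E `` {v})"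
  then obtain x where x: "{v, x} \<in> E" "y = f x" by (auto simp: adj_def)
  have "f ` {v, x} \<in> (\<lambda>e. f ` e) ` E" using x(1) by (rule imageI)
  thus "y \<in> adj ((\<lambda>e. f ` e) ` E) `` {f v}" using x by (simp add: adj_def)
qed

lemma adj_in_vertices: "simple_graph V E \<Longrightarrow> adj E `` {v} \<subseteq> V"
  by (auto simp: adj_def simple_graph_def)

definition degree :: "'a set set \<Rightarrow> 'a \<Rightarrow> nat" where
  "degree E v = card (adj E `` {v})"

lemma degree_isomorphic:
  assumes "simple_graph V E" "bij_betw f V V'" "v \<in> V"
  shows "degree ((\<lambda>e. f ` e) ` E) (f v) = degree E v"
  unfolding degree_def adj_isomorphic[OF assms]
  using assms adj_in_vertices[OF assms(1), of v] by (intro card_image) (auto simp: bij_betw_def inj_on_subset)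

lemma degree_set_isomorphic:
  assumes "simple_graph V E" "graph_isomorphic V E V' E'"
  shows "degree E' ` V' = degree E ` V"
proof -
  from assms(2) obtain f where f: "bij_betw f V V'" "E' = (\<lambda>e. f ` e) ` E"
    by (auto simp: graph_isomorphic_def)
  have "V' = f ` V" using f by (simp add: bij_betw_def)
  hence "degree E' ` V' = (\<lambda>v. degree E' (f v)) ` V" by (simp add: image_image)
  also have "\<dots> = degree E ` V"
    unfolding f(2) using degree_isomorphic[OF assms(1) f(1)] by (rule image_cong[OF refl])
  finally show ?thesis .
qed

lemma simple_graph_tree: "is_tree V E \<Longrightarrow> simple_graph V E"
  by (simp add: is_tree_def)

section \<open>Two spiders with equal small counts\<close>

definition path_edges :: "nat \<Rightarrow> nat set set" where
  "path_edges m = (\<lambda>i. {i, Suc i}) ` {..<m}"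

text \<open>The spider with legs of length \<open>1\<close>, \<open>c\<close> and \<open>m - c\<close>: vertex \<open>Suc m\<close> is the leaf hung on
  vertex \<open>c\<close> of the path \<open>0, \<dots>, m\<close>.\<close>

definition spider :: "nat \<Rightarrow> nat \<Rightarrow> nat set set" where
  "spider m c = insert {c, Suc m} (path_edges m)"

lemma is_tree_path: "is_tree {..<Suc m} (path_edges m)"
proof (induction m)
  case 0
  have "{..<Suc 0} = {0}" by auto
  thus ?case using is_tree_single_vertex[of "0::nat"] by (simp add: path_edges_def)
next
  case (Suc m)
  have "is_tree (insert (Suc m) {..<Suc m}) (insert {m, Suc m} (path_edges m))"
    using Suc by (rule is_tree_attach_leaf) auto
  thus ?case by (simp add: path_edges_def lessThan_Suc)
qed

lemma is_tree_spider:
  assumes "c \<le> m"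
  shows "is_tree {..<m + 2} (spider m c)"
proof -
  have "is_tree (insert (Suc m) {..<Suc m}) (spider m c)"
    unfolding spider_def using is_tree_path by (rule is_tree_attach_leaf) (use assms in auto)
  thus ?thesis by (simp add: lessThan_Suc)
qed

lemma spider_edge_cases:
  assumes "e \<in> spider m c"
  obtains "e = {c, Suc m}" | i where "i < m" "e = {i, Suc i}"
  using assms by (auto simp: spider_def path_edges_def)

text \<open>For \<open>q \<le> h\<close> the window is symmetric about the middle of the edge \<open>{h - 1, h}\<close>, and
  \<open>reflect h q\<close> is the reflection of it.\<close>

definition window :: "nat \<Rightarrow> nat \<Rightarrow> nat set" where
  "window h q = {h - q..<h + q}"

definition reflect :: "nat \<Rightarrow> nat \<Rightarrow> nat \<Rightarrow> nat" where
  "reflect h q v = (if v \<in> window h q then 2 * h - 1 - v else v)"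

text \<open>The pendant edge, the only one at \<open>Suc m\<close>, is exempt: it always leaves the window, and it is meant
  to be moved by the reflection from one end of the edge \<open>{h - 1, h}\<close> to the other.\<close>

definition uncrossed :: "nat \<Rightarrow> nat \<Rightarrow> nat set set \<Rightarrow> nat \<Rightarrow> bool" where
  "uncrossed m h F q \<longleftrightarrow> (\<forall>e\<in>F. Suc m \<notin> e \<longrightarrow> e \<subseteq> window h q \<or> e \<inter> window h q = {})"

definition least_window :: "nat \<Rightarrow> nat \<Rightarrow> nat set set \<Rightarrow> nat" where
  "least_window m h F = (LEAST q. 1 \<le> q \<and> uncrossed m h F q)"

text \<open>Reflecting in the smallest uncrossed window makes the choice recoverable from the image, since the
  reflection maps every smaller window to itself. So \<open>flip\<close> undoes itself.\<close>

definition flip :: "nat \<Rightarrow> nat \<Rightarrow> nat set set \<Rightarrow> nat set set" where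
  "flip m h F = (\<lambda>e. reflect h (least_window m h F) ` e) ` F"

lemma reflect_reflect: "q \<le> h \<Longrightarrow> reflect h q (reflect h q v) = v"
  by (auto simp: reflect_def window_def)

lemma reflect_outside: "q \<le> h \<Longrightarrow> 2 * h \<le> v \<Longrightarrow> reflect h q v = v"
  by (auto simp: reflect_def window_def)

lemma reflect_in_smaller_window:
  "r \<le> q \<Longrightarrow> q \<le> h \<Longrightarrow> reflect h q v \<in> window h r \<longleftrightarrow> v \<in> window h r"
  by (auto simp: reflect_def window_def)

lemma bij_betw_reflect:
  assumes "q \<le> h" "2 * h \<le> n"
  shows "bij_betw (reflect h q) {..<n} {..<n}"
proof (rule bij_betwI)
  show "reflect h q \<in> {..<n} \<rightarrow> {..<n}" using assms by (auto simp: reflect_def window_def)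
  thus "reflect h q \<in> {..<n} \<rightarrow> {..<n}" .
qed (use assms in \<open>auto simp: reflect_reflect\<close>)

lemma uncrossed_reflect:
  assumes "r \<le> q" "q \<le> h" "2 * h \<le> m"
  shows "uncrossed m h ((\<lambda>e. reflect h q ` e) ` F) r \<longleftrightarrow> uncrossed m h F r"
proof -
  have "Suc m \<in> reflect h q ` e \<longleftrightarrow> Suc m \<in> e" for e
  proof -
    have fixed: "reflect h q (Suc m) = Suc m" using assms by (intro reflect_outside) auto
    have "v = Suc m" if "Suc m = reflect h q v" for v
      using arg_cong[OF that, of "reflect h q"] fixed assms(2) by (simp add: reflect_reflect)
    thus ?thesis using fixed by (force simp: image_iff)
  qed
  moreover have "reflect h q ` e \<subseteq> window h r \<longleftrightarrow> e \<subseteq> window h r"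
    "reflect h q ` e \<inter> window h r = {} \<longleftrightarrow> e \<inter> window h r = {}" for e
    using reflect_in_smaller_window[OF assms(1,2)] by blast+
  ultimately show ?thesis by (simp add: uncrossed_def)
qed

text \<open>A path edge crosses at most one of the windows. If all \<open>h\<close> windows were crossed, \<open>F\<close> would
  contain \<open>h\<close> path edges besides the pendant edge.\<close>

lemma exists_uncrossed_window:
  assumes F: "F \<subseteq> spider m c" "{c, Suc m} \<in> F" and h: "card F \<le> h" "1 \<le> h"
  shows "\<exists>q. 1 \<le> q \<and> q \<le> h \<and> uncrossed m h F q"
proof (rule ccontr)
  assume none: "\<nexists>q. 1 \<le> q \<and> q \<le> h \<and> uncrossed m h F q"
  define I where "I = {i. i < m \<and> {i, Suc i} \<in> F}"
  \<comment> \<open>The only window that the edge \<open>{i, Suc i}\<close> can cross has index \<open>cr i\<close>; the middle edge gets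
    \<open>0\<close>, which lies outside \<open>{1..h}\<close>.\<close>
  define cr where "cr i = (if i < h then h - 1 - i else i + 1 - h)" for i
  have fin: "finite F" using F(1) by (rule finite_subset) (simp add: spider_def path_edges_def)
  have "{1..h} \<subseteq> cr ` I"
  proof
    fix q assume q: "q \<in> {1..h}"
    with none have "\<not> uncrossed m h F q" by auto
    then obtain e where e: "e \<in> F" "Suc m \<notin> e" "\<not> e \<subseteq> window h q" "e \<inter> window h q \<noteq> {}"
      by (auto simp: uncrossed_def)
    from e(1) F(1) have "e \<in> spider m c" by blast
    then obtain i where i: "i < m" "e = {i, Suc i}" using e(2) by (auto elim: spider_edge_cases)
    have "Suc i = h + q \<or> Suc i = h - q" using e(3,4) unfolding i by (auto simp: window_def)
    hence "cr i = q" using q by (auto simp: cr_def)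
    thus "q \<in> cr ` I" using i e(1) by (auto simp: I_def)
  qed
  hence "card {1..h} \<le> card I" by (rule surj_card_le[rotated]) (simp add: I_def)
  also have "\<dots> = card ((\<lambda>i. {i, Suc i}) ` I)"
    by (rule card_image[symmetric]) (auto simp: inj_on_def doubleton_eq_iff)
  also have "\<dots> \<le> card (F - {{c, Suc m}})"
    using fin by (intro card_mono) (auto simp: I_def doubleton_eq_iff)
  also have "\<dots> = card F - 1" using F(2) fin by simp
  finally show False using h by simp
qed

lemma least_window:
  assumes "F \<subseteq> spider m c" "{c, Suc m} \<in> F" "card F \<le> h" "1 \<le> h"
  shows "1 \<le> least_window m h F" "least_window m h F \<le> h" "uncrossed m h F (least_window m h F)"
proof -
  from exists_uncrossed_window[OF assms] obtain q where q: "1 \<le> q" "q \<le> h" "uncrossed m h F q"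
    by blast
  have "1 \<le> least_window m h F \<and> uncrossed m h F (least_window m h F)"
    unfolding least_window_def by (rule LeastI[of _ q]) (use q in auto)
  thus "1 \<le> least_window m h F" "uncrossed m h F (least_window m h F)" by auto
  show "least_window m h F \<le> h"
    unfolding least_window_def by (rule order_trans[OF Least_le[of _ q]]) (use q in auto)
qed

text \<open>The values \<open>h - 1\<close> and \<open>h\<close> of \<open>c\<close> are exchanged by \<open>c \<mapsto> 2 * h - 1 - c\<close>, so this treats both
  directions at once. The component type survives because the flip is induced by a permutation of
  all vertices.\<close>

lemma flip_spider:
  assumes F: "F \<subseteq> spider m c" "{c, Suc m} \<in> F" and h: "card F \<le> h" "1 \<le> h" "2 * h \<le> m"
    and c: "c \<in> {h - 1, h}"
  shows "flip m h F \<subseteq> spider m (2 * h - 1 - c)"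
    and "{2 * h - 1 - c, Suc m} \<in> flip m h F"
    and "flip m h (flip m h F) = F"
    and "component_type {..<m + 2} (flip m h F) = component_type {..<m + 2} F"
proof -
  define p where "p = least_window m h F"
  note p = least_window[OF F h(1,2), folded p_def]
  have flip: "flip m h F = (\<lambda>e. reflect h p ` e) ` F" by (simp add: flip_def p_def)
  have "c \<in> window h p" using c p(1) h(2) by (auto simp: window_def)
  hence pend: "reflect h p ` {c, Suc m} = {2 * h - 1 - c, Suc m}"
    using p(2) h by (simp add: reflect_outside) (simp add: reflect_def)
  show "{2 * h - 1 - c, Suc m} \<in> flip m h F"
    unfolding flip pend[symmetric] using F(2) by (rule imageI)
  show "flip m h F \<subseteq> spider m (2 * h - 1 - c)"
  proof
    fix d assume "d \<in> flip m h F"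
    then obtain e where e: "e \<in> F" "d = reflect h p ` e" by (auto simp: flip)
    from e(1) F(1) have "e \<in> spider m c" by blast
    thus "d \<in> spider m (2 * h - 1 - c)"
    proof (cases rule: spider_edge_cases)
      case 1
      thus ?thesis using e pend by (simp add: spider_def)
    next
      case (2 i)
      hence "Suc m \<notin> e" by auto
      with p(3) e(1) have "e \<subseteq> window h p \<or> e \<inter> window h p = {}" by (auto simp: uncrossed_def)
      thus ?thesis
      proof
        assume "e \<inter> window h p = {}"
        hence "d = {i, Suc i}" using e 2 by (simp add: reflect_def)
        thus ?thesis using 2 by (simp add: spider_def path_edges_def)
      next
        assume W: "e \<subseteq> window h p"
        hence "Suc i < 2 * h" using 2 p(2) by (auto simp: window_def)
        hence "2 * h - 1 - i = Suc (2 * h - 1 - Suc i)" "2 * h - 1 - Suc i < m"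
          using h by auto
        moreover have "d = {2 * h - 1 - i, 2 * h - 1 - Suc i}"
          using W e 2 by (simp add: reflect_def)
        ultimately have "d = {2 * h - 1 - Suc i, Suc (2 * h - 1 - Suc i)}" by auto
        thus ?thesis using \<open>2 * h - 1 - Suc i < m\<close>
          unfolding spider_def path_edges_def by (intro insertI2) (rule image_eqI, auto)
      qed
    qed
  qed
  \<comment> \<open>Windows up to \<open>p\<close> are mapped to themselves, so the same ones are uncrossed before and after.\<close>
  have "least_window m h (flip m h F) = p"
    unfolding least_window_def
  proof (rule Least_equality)
    show "1 \<le> p \<and> uncrossed m h (flip m h F) p"
      using p uncrossed_reflect[OF order_refl p(2) h(3)] by (simp add: flip)
    fix q assume q: "1 \<le> q \<and> uncrossed m h (flip m h F) q"
    show "p \<le> q"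
    proof (rule ccontr)
      assume "\<not> p \<le> q"
      hence "uncrossed m h F q" using q uncrossed_reflect[of q p h m F] p(2) h(3) by (simp add: flip)
      hence "p \<le> q" unfolding p_def least_window_def using q by (intro Least_le) auto
      with \<open>\<not> p \<le> q\<close> show False ..
    qed
  qed
  thus "flip m h (flip m h F) = F"
    unfolding flip_def[of m h "flip m h F"] by (simp add: flip image_image reflect_reflect p(2))
  have "\<forall>e\<in>F. e \<subseteq> {..<m + 2}"
  proof -
    have "c \<le> m" using c h by auto
    from simple_graph_tree[OF is_tree_spider[OF this]] F(1) show ?thesis
      unfolding simple_graph_def by blast
  qed
  thus "component_type {..<m + 2} (flip m h F) = component_type {..<m + 2} F"
    unfolding flip using p(2) h(3) by (intro component_type_image bij_betw_reflect) auto
qed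

text \<open>The edge sets without the pendant edge are literally the same for both spiders; those with it are
  matched by \<open>flip\<close>.\<close>

lemma num_edge_sets_spider:
  assumes h: "1 \<le> h" "2 * h \<le> m" and t: "t \<le> h" and \<mu>: "\<mu> \<in> large_partitions (m + 2) t"
  shows "num_edge_sets {..<m + 2} (spider m h) \<mu> = num_edge_sets {..<m + 2} (spider m (h - 1)) \<mu>"
proof -
  define X where "X c = {F. F \<subseteq> spider m c \<and> {c, Suc m} \<in> F \<and> component_type {..<m + 2} F = \<mu>}" for c
  define Y where "Y = {F. F \<subseteq> path_edges m \<and> component_type {..<m + 2} F = \<mu>}"
  have fin: "finite (spider m c)" for c by (simp add: spider_def path_edges_def)
  have split: "num_edge_sets {..<m + 2} (spider m c) \<mu> = card (X c) + card Y" for c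
  proof -
    have "{c, Suc m} \<notin> path_edges m" by (auto simp: path_edges_def doubleton_eq_iff)
    hence "{F. F \<subseteq> spider m c \<and> component_type {..<m + 2} F = \<mu>} = X c \<union> Y" "X c \<inter> Y = {}"
      by (auto simp: X_def Y_def spider_def)
    moreover have "finite (X c)" "finite Y"
      using fin[of c] by (auto simp: X_def Y_def path_edges_def)
    ultimately show ?thesis by (simp add: num_edge_sets_def card_Un_disjoint)
  qed
  have small: "card F \<le> h" if "F \<in> X c" "c \<in> {h - 1, h}" for F c
  proof -
    have "is_tree {..<m + 2} (spider m c)" using that h by (intro is_tree_spider) auto
    hence "card F \<le> t" by (rule large_type_few_edges) (use that \<mu> in \<open>auto simp: X_def\<close>)
    thus ?thesis using t by simp
  qed
  have maps: "flip m h F \<in> X (2 * h - 1 - c) \<and> flip m h (flip m h F) = F"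
    if "F \<in> X c" "c \<in> {h - 1, h}" for F c
    using flip_spider[of F m c h] that small[OF that] h by (simp add: X_def)
  have c: "2 * h - 1 - h = h - 1" "2 * h - 1 - (h - 1) = h" using h by auto
  have "bij_betw (flip m h) (X h) (X (h - 1))"
    by (rule bij_betw_byWitness[of _ "flip m h"])
       (use maps[of _ h, unfolded c] maps[of _ "h - 1", unfolded c] in auto)
  thus ?thesis unfolding split by (simp add: bij_betw_same_card)
qed

primrec within_distance :: "'a set set \<Rightarrow> nat \<Rightarrow> 'a \<Rightarrow> 'a set" where
  "within_distance E 0 v = {v}"
| "within_distance E (Suc n) v = within_distance E n v \<union> adj E `` within_distance E n v"

lemma within_distance_isomorphic:
  assumes "simple_graph V E" "bij_betw f V V'" "v \<in> V"
  shows "within_distance E n v \<subseteq> V"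
    "within_distance ((\<lambda>e. f ` e) ` E) n (f v) = f ` within_distance E n v"
proof -
  have *: "within_distance E n v \<subseteq> V" for n
    by (induction n) (use assms(1,3) in \<open>auto simp: adj_def simple_graph_def\<close>)
  show "within_distance E n v \<subseteq> V" by (rule *)
  show "within_distance ((\<lambda>e. f ` e) ` E) n (f v) = f ` within_distance E n v"
  proof (induction n)
    case (Suc n)
    have "adj ((\<lambda>e. f ` e) ` E) `` (f ` B) = f ` (adj E `` B)" if "B \<subseteq> V" for B
    proof -
      have "adj ((\<lambda>e. f ` e) ` E) `` (f ` B) = (\<Union>x\<in>B. adj ((\<lambda>e. f ` e) ` E) `` {f x})" by auto
      also have "\<dots> = (\<Union>x\<in>B. f ` (adj E `` {x}))"
        using adj_isomorphic[OF assms(1,2)] that by (intro SUP_cong) auto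
      also have "\<dots> = f ` (adj E `` B)" by auto
      finally show ?thesis .
    qed
    from this[OF *] Suc show ?case by (simp add: image_Un)
  qed simp
qed

lemma adj_spider:
  "(x, y) \<in> adj (spider m c) \<longleftrightarrow>
     (x = c \<and> y = Suc m) \<or> (x = Suc m \<and> y = c) \<or> (y = Suc x \<and> x < m) \<or> (x = Suc y \<and> y < m)"
  by (auto simp: adj_def spider_def path_edges_def doubleton_eq_iff)

lemma degree_branch_vertex:
  assumes "1 \<le> c" "c < m"
  shows "degree (spider m c) c = 3"
proof -
  have "adj (spider m c) `` {c} = {c - 1, Suc c, Suc m}" using assms by (auto simp: adj_spider)
  moreover have "c - 1 \<noteq> Suc c" "c - 1 \<noteq> Suc m" "Suc c \<noteq> Suc m" using assms by auto
  ultimately show ?thesis by (simp add: degree_def)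
qed

lemma degree_other_vertex:
  assumes "x \<noteq> c"
  shows "degree (spider m c) x \<le> 2"
proof -
  have "\<exists>a b. adj (spider m c) `` {x} \<subseteq> {a, b}"
  proof (cases "x = Suc m")
    case True thus ?thesis by (intro exI[of _ c] exI[of _ m]) (auto simp: adj_spider)
  next
    case False thus ?thesis using assms
      by (intro exI[of _ "Suc x"] exI[of _ "x - 1"]) (auto simp: adj_spider)
  qed
  then obtain a b where "adj (spider m c) `` {x} \<subseteq> {a, b}" by blast
  hence "card (adj (spider m c) `` {x}) \<le> card {a, b}" by (intro card_mono) auto
  also have "\<dots> \<le> 2" by (cases "a = b") auto
  finally show ?thesis by (simp add: degree_def)
qed

lemma within_distance_upper:
  assumes "c < b"
  shows "within_distance (spider m c) n c \<subseteq> insert (Suc m) {..<b + n}"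
proof (induction n)
  case (Suc n)
  have "y \<in> insert (Suc m) {..<b + Suc n}"
    if "x \<in> within_distance (spider m c) n c" "(x, y) \<in> adj (spider m c)" for x y
    using Suc that assms by (auto simp: adj_spider)
  thus ?case using Suc by auto
qed (use assms in auto)

lemma within_distance_lower:
  assumes "c + n \<le> m"
  shows "{c - n..c + n} \<subseteq> within_distance (spider m c) n c"
  using assms
proof (induction n)
  case (Suc n)
  have "y \<in> within_distance (spider m c) (Suc n) c" if y: "y \<in> {c - Suc n..c + Suc n}" for y
  proof (cases "y \<in> {c - n..c + n}")
    case True
    thus ?thesis using Suc by auto
  next
    case False
    define x where "x = (if y < c then Suc y else y - 1)"
    have "x \<in> {c - n..c + n}" "(x, y) \<in> adj (spider m c)"
      using False y Suc.prems by (auto simp: x_def adj_spider)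
    moreover have "{c - n..c + n} \<subseteq> within_distance (spider m c) n c" using Suc by simp
    ultimately show ?thesis by auto
  qed
  thus ?case by blast
qed simp

text \<open>An isomorphism maps the vertex \<open>h\<close> of degree three to a vertex of degree three, which can only be
  \<open>h - 1\<close>. Within distance \<open>h\<close> of the branch vertex lie \<open>2 * h + 2\<close> vertices of the first spider,
  since both long legs have length at least \<open>h\<close>, but only \<open>2 * h + 1\<close> of the second, whose left leg has length \<open>h - 1\<close>. For \<open>h = 1\<close> the second spider is a
  path and has no vertex of degree three; the argument covers this case because it uses only that
  every vertex other than \<open>h - 1\<close> has degree at most two.\<close>

lemma spiders_not_isomorphic:
  assumes h: "1 \<le> h" "2 * h \<le> m"
  shows "\<not> graph_isomorphic {..<m + 2} (spider m h) {..<m + 2} (spider m (h - 1))"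
proof
  assume "graph_isomorphic {..<m + 2} (spider m h) {..<m + 2} (spider m (h - 1))"
  then obtain f where f: "bij_betw f {..<m + 2} {..<m + 2}"
    and E: "(\<lambda>e. f ` e) ` spider m h = spider m (h - 1)"
    by (auto simp: graph_isomorphic_def)
  have sg: "simple_graph {..<m + 2} (spider m h)"
    using h by (intro simple_graph_tree is_tree_spider) auto
  have hV: "h \<in> {..<m + 2}" using h by auto
  have "degree (spider m (h - 1)) (f h) = 3"
    using degree_isomorphic[OF sg f hV] degree_branch_vertex[of h m] h by (simp add: E)
  hence fh: "f h = h - 1" using degree_other_vertex[of "f h" "h - 1" m] by fastforce
  let ?A = "within_distance (spider m h) h h"
  have sub: "?A \<subseteq> {..<m + 2}" and img: "within_distance (spider m (h - 1)) h (h - 1) = f ` ?A"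
    using within_distance_isomorphic[OF sg f hV, of h] by (simp_all add: E fh)
  have "Suc m \<in> ?A"
  proof -
    have "Suc m \<in> within_distance (spider m h) (Suc n) h" for n
      by (induction n) (auto simp: adj_spider)
    from this[of "h - 1"] show ?thesis using h by simp
  qed
  moreover have "{..2 * h} \<subseteq> ?A" using within_distance_lower[of h h m] h by (auto simp: mult_2)
  ultimately have "card (insert (Suc m) {..2 * h}) \<le> card ?A"
    using finite_subset[OF sub] by (intro card_mono) auto
  hence "2 * h + 2 \<le> card ?A" using h by simp
  also have "card ?A = card (f ` ?A)"
    using f sub by (intro card_image[symmetric]) (auto simp: bij_betw_def inj_on_subset)
  also have "f ` ?A \<subseteq> insert (Suc m) {..<2 * h}"
    unfolding img[symmetric] using within_distance_upper[of "h - 1" h m h] h by (simp add: mult_2)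
  hence "card (f ` ?A) \<le> card (insert (Suc m) {..<2 * h})" by (intro card_mono) auto
  also have "\<dots> \<le> 2 * h + 1" by (simp add: card_insert_if)
  finally show False by simp
qed

lemma signature_eqI:
  assumes "E \<in> labelled_trees k" "E' \<in> labelled_trees k"
    "\<And>\<mu>. \<mu> \<in> large_partitions k t \<Longrightarrow> num_edge_sets {..<k} E \<mu> = num_edge_sets {..<k} E' \<mu>"
  shows "signature k t (tree_iso k `` {E}) = signature k t (tree_iso k `` {E'})"
  unfolding signature_def
  by (intro restrict_ext) (simp add: tree_count_class assms)

lemma tree_class_eq_iff:
  assumes "E \<in> labelled_trees k" "E' \<in> labelled_trees k"
  shows "tree_iso k `` {E} = tree_iso k `` {E'} \<longleftrightarrow> graph_isomorphic {..<k} E {..<k} E'"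
  using eq_equiv_class_iff[OF equiv_tree_iso assms] assms by (simp add: tree_iso_def)

lemma signature_not_injective:
  assumes k: "4 \<le> k" and t: "t < k div 2"
  shows "\<not> inj_on (signature k t) (trees k)"
proof
  assume inj: "inj_on (signature k t) (trees k)"
  define m h where "m = k - 2" and "h = k div 2 - 1"
  have h: "1 \<le> h" "2 * h \<le> m" "t \<le> h" and km: "k = m + 2"
    using k t by (auto simp: m_def h_def)
  have L: "spider m h \<in> labelled_trees k" "spider m (h - 1) \<in> labelled_trees k"
    using is_tree_spider[of h m] is_tree_spider[of "h - 1" m] h by (simp_all add: labelled_trees_def km)
  have "signature k t (tree_iso k `` {spider m h}) = signature k t (tree_iso k `` {spider m (h - 1)})"
    using L num_edge_sets_spider[OF h] by (intro signature_eqI) (auto simp: km)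
  hence "tree_iso k `` {spider m h} = tree_iso k `` {spider m (h - 1)}"
    using inj L by (auto simp: trees_def quotientI dest: inj_onD)
  thus False using spiders_not_isomorphic[OF h(1,2)] tree_class_eq_iff[OF L] by (simp add: km)
qed

text \<open>The value \<open>\<infinity>\<close> in the definition of \<open>tau\<close> guarantees that the least element is attained.\<close>

lemma tau_ge:
  assumes "4 \<le> k"
  shows "enat (k div 2) \<le> tau k"
proof -
  have "tau k \<in> enat ` {t. inj_on (signature k t) (trees k)} \<union> {\<infinity>}"
    unfolding tau_def by (rule LeastI[of _ \<infinity>]) simp
  thus ?thesis using signature_not_injective[OF assms] by (force simp: not_less[symmetric])
qed

section \<open>Few signatures\<close>

lemma size_le_sum_mset: "0 \<notin># M \<Longrightarrow> size M \<le> sum_mset M" for M :: "nat multiset"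
  by (induction M) auto

lemma large_partition_part_le:
  assumes "\<mu> \<in> large_partitions k t" "x \<in># \<mu>"
  shows "x \<le> t + 1"
proof -
  from assms(2) obtain \<nu> where \<nu>: "\<mu> = add_mset x \<nu>" by (metis multi_member_split)
  have "size \<nu> \<le> sum_mset \<nu>"
    using assms(1) by (intro size_le_sum_mset) (auto simp: \<nu> large_partitions_def partitions_def)
  thus ?thesis using assms(1) by (auto simp: \<nu> large_partitions_def partitions_def)
qed

lemma large_partition_count_le:
  assumes "\<mu> \<in> large_partitions k t" "2 \<le> i"
  shows "count \<mu> i \<le> t"
proof -
  define \<nu> where "\<nu> = filter_mset (\<lambda>x. x \<noteq> i) \<mu>"
  have \<mu>: "\<mu> = replicate_mset (count \<mu> i) i + \<nu>"
    unfolding \<nu>_def by (rule multiset_eqI) auto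
  have "size \<nu> \<le> sum_mset \<nu>"
    using assms(1) by (intro size_le_sum_mset) (auto simp: \<nu>_def large_partitions_def partitions_def)
  moreover have "size \<mu> = count \<mu> i + size \<nu>" by (subst \<mu>) simp
  moreover have "sum_mset \<mu> = count \<mu> i * i + sum_mset \<nu>" by (subst \<mu>) simp
  moreover have "count \<mu> i * 2 \<le> count \<mu> i * i" using assms(2) by simp
  moreover have "sum_mset \<mu> = k" "k \<le> size \<mu> + t"
    using assms(1) by (auto simp: large_partitions_def partitions_def)
  ultimately show ?thesis by linarith
qed

text \<open>Such a partition is recoverable from the multiplicities of the parts from \<open>2\<close> to \<open>t + 1\<close>: there are
  no larger parts, and the number of ones is what is missing to the sum \<open>k\<close>. Each of these
  multiplicities is at most \<open>t\<close>. The bound does not involve \<open>k\<close>.\<close>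

lemma card_large_partitions:
  shows "finite (large_partitions k t)" and "card (large_partitions k t) \<le> (t + 1) ^ t"
proof -
  define g where "g \<mu> = restrict (count \<mu>) {2..t + 1}" for \<mu> :: "nat multiset"
  have inj: "inj_on g (large_partitions k t)"
  proof (rule inj_onI)
    fix \<mu> \<nu> assume \<mu>: "\<mu> \<in> large_partitions k t" and \<nu>: "\<nu> \<in> large_partitions k t" and eq: "g \<mu> = g \<nu>"
    have big: "filter_mset (\<lambda>x. 2 \<le> x) \<mu> = filter_mset (\<lambda>x. 2 \<le> x) \<nu>"
    proof (rule multiset_eqI)
      fix x
      show "count (filter_mset (\<lambda>x. 2 \<le> x) \<mu>) x = count (filter_mset (\<lambda>x. 2 \<le> x) \<nu>) x"
      proof (cases "x \<le> t + 1")
        case True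
        thus ?thesis using fun_cong[OF eq, of x] by (auto simp: g_def)
      next
        case False
        hence "x \<notin># \<mu>" "x \<notin># \<nu>" using large_partition_part_le \<mu> \<nu> by blast+
        thus ?thesis by (simp add: not_in_iff)
      qed
    qed
    have split: "\<rho> = replicate_mset (count \<rho> 1) 1 + filter_mset (\<lambda>x. 2 \<le> x) \<rho>"
      if "\<rho> \<in> large_partitions k t" for \<rho>
    proof (rule multiset_eqI)
      fix x
      have "count \<rho> 0 = 0" using that by (simp add: large_partitions_def partitions_def not_in_iff)
      thus "count \<rho> x = count (replicate_mset (count \<rho> 1) 1 + filter_mset (\<lambda>x. 2 \<le> x) \<rho>) x"
        by (cases "x = 0"; cases "x = 1") auto
    qed
    have "k = count \<rho> 1 + sum_mset (filter_mset (\<lambda>x. 2 \<le> x) \<rho>)"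
      if "\<rho> \<in> large_partitions k t" for \<rho>
      using arg_cong[OF split[OF that], of sum_mset] that
      by (simp add: large_partitions_def partitions_def)
    from this[OF \<mu>] this[OF \<nu>] have "count \<mu> 1 = count \<nu> 1" by (simp add: big)
    thus "\<mu> = \<nu>" using split[OF \<mu>] split[OF \<nu>] big by simp
  qed
  have img: "g ` large_partitions k t \<subseteq> {2..t + 1} \<rightarrow>\<^sub>E {..t}"
    using large_partition_count_le by (auto simp: g_def)
  have fin: "finite ({2..t + 1} \<rightarrow>\<^sub>E {..t})" by (intro finite_PiE) auto
  show "finite (large_partitions k t)"
    using finite_imageD[OF finite_subset[OF img fin] inj] .
  have "card (large_partitions k t) \<le> card ({2..t + 1} \<rightarrow>\<^sub>E {..t})"
    by (rule card_inj_on_le[OF inj img fin])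
  also have "\<dots> = (t + 1) ^ t" by (simp add: card_funcsetE)
  finally show "card (large_partitions k t) \<le> (t + 1) ^ t" .
qed

text \<open>Only sets of at most \<open>t\<close> edges count, and each is the set of entries of a list of length at most
  \<open>t\<close>.\<close>

lemma num_edge_sets_le:
  assumes T: "is_tree V E" and \<mu>: "\<mu> \<in> large_partitions (card V) t" and V: "V \<noteq> {}"
  shows "num_edge_sets V E \<mu> \<le> (t + 1) * card V ^ t"
proof -
  have fin: "finite V" "finite E"
    using simple_graph_tree[OF T] finite_subset[of E "Pow V"] by (auto simp: simple_graph_def)
  have E: "card E \<le> card V"
    using forest_components_plus_edges[of V E] T by (auto simp: is_tree_def)
  let ?L = "{xs. set xs \<subseteq> E \<and> length xs \<le> t}"
  have "{F. F \<subseteq> E \<and> component_type V F = \<mu>} \<subseteq> set ` ?L"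
  proof
    fix F assume "F \<in> {F. F \<subseteq> E \<and> component_type V F = \<mu>}"
    hence F: "F \<subseteq> E" "card F \<le> t" using large_type_few_edges[OF T] \<mu> by auto
    obtain xs where "set xs = F" "distinct xs"
      using finite_distinct_list finite_subset[OF F(1) fin(2)] by blast
    thus "F \<in> set ` ?L" using F by (intro image_eqI[of _ _ xs]) (auto simp: distinct_card)
  qed
  moreover have finL: "finite ?L" by (rule finite_lists_length_le[OF fin(2)])
  ultimately have "num_edge_sets V E \<mu> \<le> card (set ` ?L)"
    unfolding num_edge_sets_def by (intro card_mono) auto
  also have "\<dots> \<le> card ?L" by (rule card_image_le[OF finL])
  also have "\<dots> = (\<Sum>i\<le>t. card E ^ i)" by (rule card_lists_length_le[OF fin(2)])
  also have "\<dots> \<le> (\<Sum>i\<le>t. card V ^ t)"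
  proof (rule sum_mono)
    fix i assume "i \<in> {..t}"
    have "card E ^ i \<le> card V ^ i" using E by (rule power_mono) simp
    also have "\<dots> \<le> card V ^ t"
      using \<open>i \<in> {..t}\<close> V fin(1) by (intro power_increasing) (auto simp: Suc_le_eq card_gt_0_iff)
    finally show "card E ^ i \<le> card V ^ t" .
  qed
  finally show ?thesis by simp
qed

lemma treesE:
  assumes "S \<in> trees k"
  obtains E where "E \<in> labelled_trees k" "S = tree_iso k `` {E}"
  using assms by (auto simp: trees_def elim: quotientE)

lemma card_signatures_le:
  assumes "1 \<le> k"
  shows "card (signature k t ` trees k) \<le> ((t + 1) * k ^ t + 1) ^ ((t + 1) ^ t)"
proof -
  let ?B = "(t + 1) * k ^ t"
  let ?P = "large_partitions k t \<rightarrow>\<^sub>E {..?B}"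
  have "signature k t ` trees k \<subseteq> ?P"
  proof
    fix \<sigma> assume "\<sigma> \<in> signature k t ` trees k"
    then obtain E where E: "E \<in> labelled_trees k" "\<sigma> = signature k t (tree_iso k `` {E})"
      by (auto elim: treesE)
    have "num_edge_sets {..<k} E \<mu> \<le> ?B" if "\<mu> \<in> large_partitions k t" for \<mu>
      using num_edge_sets_le[of "{..<k}" E \<mu> t] E(1) that assms
      by (auto simp: labelled_trees_def lessThan_empty_iff)
    thus "\<sigma> \<in> ?P" by (auto simp: E signature_def tree_count_class)
  qed
  hence "card (signature k t ` trees k) \<le> card ?P"
    by (intro card_mono finite_PiE) (auto simp: card_large_partitions)
  also have "\<dots> = (?B + 1) ^ card (large_partitions k t)"
    by (simp add: card_funcsetE card_large_partitions)
  also have "\<dots> \<le> (?B + 1) ^ ((t + 1) ^ t)"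
    by (intro power_increasing card_large_partitions) simp
  finally show ?thesis .
qed

text \<open>On the points that are alone in their fibre, \<open>f\<close> is injective.\<close>

lemma card_singleton_fibres_le:
  assumes "finite A"
  shows "card {x \<in> A. f -` {f x} \<inter> A = {x}} \<le> card (f ` A)"
  by (rule card_inj_on_le[of f]) (use assms in \<open>auto simp: inj_on_def\<close>)

section \<open>Many trees\<close>

lemma is_tree_attach_leaves:
  fixes n :: nat
  assumes "is_tree {..<n} E" "x < n"
  shows "is_tree {..<n + a} (E \<union> (\<lambda>j. {x, j}) ` {n..<n + a})"
proof (induction a)
  case (Suc a)
  have "is_tree (insert (n + a) {..<n + a}) (insert {x, n + a} (E \<union> (\<lambda>j. {x, j}) ` {n..<n + a}))"
    using Suc.IH by (rule is_tree_attach_leaf) (use assms(2) in auto)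
  moreover have "{n..<n + Suc a} = insert (n + a) {n..<n + a}" by auto
  ultimately show ?case by (simp add: lessThan_Suc)
qed (use assms in simp)

lemma degrees_attach_leaves:
  fixes n :: nat
  assumes sg: "simple_graph {..<n} E" and x: "x < n" and E': "E' = E \<union> (\<lambda>j. {x, j}) ` {n..<n + a}"
  shows "degree E' x = degree E x + a"
    and "y < n \<Longrightarrow> y \<noteq> x \<Longrightarrow> degree E' y = degree E y"
    and "y \<in> {n..<n + a} \<Longrightarrow> degree E' y = 1"
proof -
  have E: "u < n" if "{u, v} \<in> E" for u v using sg that by (auto simp: simple_graph_def)
  have "adj E' `` {x} = adj E `` {x} \<union> {n..<n + a}"
    using x by (auto simp: E' adj_def doubleton_eq_iff)
  moreover have "adj E `` {x} \<inter> {n..<n + a} = {}" "finite (adj E `` {x})"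
    using adj_in_vertices[OF sg, of x] finite_subset[of "adj E `` {x}" "{..<n}"] by auto
  ultimately show "degree E' x = degree E x + a"
    by (simp add: degree_def card_Un_disjoint)
  show "degree E' y = degree E y" if "y < n" "y \<noteq> x"
  proof -
    have "adj E' `` {y} = adj E `` {y}" using that by (auto simp: E' adj_def doubleton_eq_iff)
    thus ?thesis by (simp add: degree_def)
  qed
  show "degree E' y = 1" if "y \<in> {n..<n + a}"
  proof -
    have "{y, v} \<notin> E" for v using E[of y v] that by auto
    hence "adj E' `` {y} = {x}" using that x by (auto simp: E' adj_def doubleton_eq_iff)
    thus ?thesis by (simp add: degree_def)
  qed
qed

text \<open>Repeatedly hang \<open>a\<close> leaves on the leaf that was created last: this vertex gets degree \<open>a + 1\<close>, all
  other degrees are kept, and a fresh leaf is available for the next step. The result is a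
  caterpillar. The induction starts with a single edge, which accounts for the two extra
  vertices.\<close>

lemma tree_with_degree_set:
  assumes "\<forall>a\<in>set as. 1 \<le> a"
  shows "\<exists>E. is_tree {..<2 + sum_list as} E \<and> degree E (1 + sum_list as) = 1 \<and>
           degree E ` {..<2 + sum_list as} = insert 1 (Suc ` set as)"
  using assms
proof (induction as)
  case Nil
  have T: "is_tree {..<2} (path_edges 1)" using is_tree_path[of 1] unfolding Suc_1 .
  have "path_edges 1 = {{0, 1}}" by (simp add: path_edges_def lessThan_Suc)
  hence "adj (path_edges 1) = {(0, 1), (1, 0)}" by (auto simp: adj_def doubleton_eq_iff)
  hence "adj (path_edges 1) `` {0} = {1}" "adj (path_edges 1) `` {1} = {0}" by auto
  hence deg: "degree (path_edges 1) 0 = 1" "degree (path_edges 1) 1 = 1" by (simp_all add: degree_def)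
  have "{..<2} = {0, 1::nat}" by auto
  with deg have "degree (path_edges 1) ` {..<2} = {1}" by simp
  with T deg(2) show ?case by (intro exI[of _ "path_edges 1"]) simp
next
  case (Cons a as)
  define n where "n = 2 + sum_list as"
  define x where "x = 1 + sum_list as"
  from Cons obtain E where T: "is_tree {..<n} E" and dx: "degree E x = 1"
    and D: "degree E ` {..<n} = insert 1 (Suc ` set as)" unfolding n_def x_def by auto
  have a: "1 \<le> a" using Cons.prems by simp
  have x: "x < n" by (simp add: n_def x_def)
  define E' where "E' = E \<union> (\<lambda>j. {x, j}) ` {n..<n + a}"
  note deg = degrees_attach_leaves[OF simple_graph_tree[OF T] x E'_def]
  have V: "{..<n + a} = insert x ({..<n} - {x}) \<union> {n..<n + a}" using x by auto
  have "degree E' ` {n..<n + a} = (\<lambda>_. 1) ` {n..<n + a}"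
    by (rule image_cong[OF refl deg(3)])
  also have "\<dots> = {1}" using a by (simp add: image_constant_conv)
  finally have "degree E' ` {n..<n + a} = {1}" .
  moreover have "degree E' ` ({..<n} - {x}) = degree E ` ({..<n} - {x})"
    by (rule image_cong[OF refl]) (rule deg(2), auto)
  ultimately have "degree E' ` {..<n + a} =
      insert (Suc a) (insert 1 (degree E ` ({..<n} - {x})))"
    unfolding V by (simp add: image_Un deg(1) dx del: insert_Diff_single)
  also have "insert 1 (degree E ` ({..<n} - {x})) = degree E ` insert x ({..<n} - {x})"
    by (simp only: image_insert dx)
  also have "insert x ({..<n} - {x}) = {..<n}" using x by auto
  also have "insert (Suc a) (degree E ` {..<n}) = insert 1 (Suc ` set (a # as))"
    by (auto simp: D)
  finally have "degree E' ` {..<n + a} = insert 1 (Suc ` set (a # as))" .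
  moreover have "degree E' (n + a - 1) = 1" using a by (intro deg(3)) auto
  moreover have "is_tree {..<n + a} E'" unfolding E'_def by (rule is_tree_attach_leaves[OF T x])
  moreover have "2 + sum_list (a # as) = n + a" "1 + sum_list (a # as) = n + a - 1"
    by (simp_all add: n_def)
  ultimately have "is_tree {..<2 + sum_list (a # as)} E' \<and> degree E' (1 + sum_list (a # as)) = 1 \<and>
      degree E' ` {..<2 + sum_list (a # as)} = insert 1 (Suc ` set (a # as))"
    by (simp only:)
  thus ?case ..
qed

text \<open>Degree sets are isomorphism invariants. Entries equal to \<open>1\<close> in the list of the previous lemma
  only produce vertices of degree two; they serve to bring the number of vertices up to \<open>k\<close>. What
  remains visible above degree two is exactly the prescribed set, so different subsets of
  \<open>{2..s}\<close> give different trees.\<close>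

lemma card_trees_ge:
  assumes k: "s * s + 2 \<le> k"
  shows "2 ^ (s - 1) \<le> card (trees k)"
proof -
  have "\<exists>E\<in>labelled_trees k. degree E ` {..<k} \<inter> {3..} = Suc ` A" if A: "A \<subseteq> {2..s}" for A
  proof -
    have finA: "finite A" using A finite_subset by blast
    have "\<Sum>A \<le> of_nat (card A) * s" using A by (intro sum_bounded_above) auto
    also have "of_nat (card A) * s \<le> s * s"
    proof -
      have "card A \<le> card {2..s}" using A by (intro card_mono) auto
      thus ?thesis by (intro mult_right_mono) auto
    qed
    finally have sum: "2 + \<Sum>A \<le> k" using k by simp
    define as where "as = replicate (k - 2 - \<Sum>A) 1 @ sorted_list_of_set A"
    have "sum_list as = k - 2"
      using sum finA sum_list_distinct_conv_sum_set[of "sorted_list_of_set A" "\<lambda>x. x"]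
      by (simp add: as_def sum_list_replicate)
    hence n: "2 + sum_list as = k" using sum by simp
    have set: "A \<subseteq> set as" "set as \<subseteq> insert 1 A" using finA by (auto simp: as_def)
    have "\<forall>a\<in>set as. 1 \<le> a" using set(2) A by auto
    from tree_with_degree_set[OF this] obtain E
      where E: "is_tree {..<k} E" "degree E ` {..<k} = insert 1 (Suc ` set as)"
      unfolding n by blast
    have "insert 1 (Suc ` set as) \<inter> {3..} \<subseteq> Suc ` A" using set(2) by auto
    moreover have "Suc ` A \<subseteq> insert 1 (Suc ` set as) \<inter> {3..}" using set(1) A by auto
    ultimately have "degree E ` {..<k} \<inter> {3..} = Suc ` A" unfolding E(2) by (rule equalityI)
    thus ?thesis using E(1) by (auto simp: labelled_trees_def)
  qed
  then obtain \<T> where \<T>: "\<And>A. A \<subseteq> {2..s} \<Longrightarrow> \<T> A \<in> labelled_trees k"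
    "\<And>A. A \<subseteq> {2..s} \<Longrightarrow> degree (\<T> A) ` {..<k} \<inter> {3..} = Suc ` A" by metis
  have "inj_on (\<lambda>A. tree_iso k `` {\<T> A}) (Pow {2..s})"
  proof (rule inj_onI)
    fix A B assume AB: "A \<in> Pow {2..s}" "B \<in> Pow {2..s}"
      and "tree_iso k `` {\<T> A} = tree_iso k `` {\<T> B}"
    hence "graph_isomorphic {..<k} (\<T> A) {..<k} (\<T> B)"
      using tree_class_eq_iff \<T>(1) by auto
    moreover have "simple_graph {..<k} (\<T> A)"
      using \<T>(1) AB by (auto simp: labelled_trees_def is_tree_def)
    ultimately have "degree (\<T> B) ` {..<k} = degree (\<T> A) ` {..<k}" by (intro degree_set_isomorphic)
    hence "Suc ` A = Suc ` B" using \<T>(2)[of A] \<T>(2)[of B] AB by simp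
    thus "A = B" by (simp add: inj_image_eq_iff)
  qed
  moreover have "(\<lambda>A. tree_iso k `` {\<T> A}) ` Pow {2..s} \<subseteq> trees k"
    using \<T>(1) by (auto simp: trees_def intro: quotientI)
  ultimately have "card (Pow {2..s}) \<le> card (trees k)"
    by (rule card_inj_on_le) (rule finite_trees)
  thus ?thesis by (simp add: card_Pow)
qed

text \<open>With \<open>s\<close> the integer part of the square root of \<open>k - 2\<close>; the \<open>2\<close> subtracted in the exponent absorbs
  the rounding and the \<open>1\<close> in \<open>s - 1\<close>.\<close>

lemma unique_fraction_le:
  assumes k: "t + 2 \<le> k"
  shows "real (card {T \<in> trees k. signature k t -` {signature k t T} \<inter> trees k = {T}})
           / real (card (trees k))
         \<le> real k ^ ((t + 1) * (t + 1) ^ t) / 2 powr (sqrt (real k - 2) - 2)"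
proof (rule frac_le)
  have "card {T \<in> trees k. signature k t -` {signature k t T} \<inter> trees k = {T}}
      \<le> card (signature k t ` trees k)"
    by (rule card_singleton_fibres_le[OF finite_trees])
  also have "\<dots> \<le> ((t + 1) * k ^ t + 1) ^ ((t + 1) ^ t)"
    using k by (intro card_signatures_le) simp
  also have "\<dots> \<le> (k ^ (t + 1)) ^ ((t + 1) ^ t)"
  proof (rule power_mono)
    have "1 \<le> k ^ t" using k by simp
    hence "(t + 1) * k ^ t + 1 \<le> (t + 2) * k ^ t" by simp
    also have "\<dots> \<le> k * k ^ t" using k by (intro mult_right_mono) auto
    finally show "(t + 1) * k ^ t + 1 \<le> k ^ (t + 1)" by simp
  qed simp
  also have "\<dots> = k ^ ((t + 1) * (t + 1) ^ t)" by (rule power_mult[symmetric])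
  finally show "real (card {T \<in> trees k. signature k t -` {signature k t T} \<inter> trees k = {T}})
      \<le> real k ^ ((t + 1) * (t + 1) ^ t)"
    by (subst of_nat_power[symmetric]) (simp only: of_nat_le_iff)
  have k2: "2 \<le> k" using k by simp
  define s where "s = nat \<lfloor>sqrt (real k - 2)\<rfloor>"
  have s: "real s \<le> sqrt (real k - 2)" "sqrt (real k - 2) - 1 \<le> real s"
    using k2 by (auto simp: s_def)
  have "real s * real s \<le> sqrt (real k - 2) * sqrt (real k - 2)"
    using s(1) k2 by (intro mult_mono) auto
  also have "\<dots> = real k - 2" using k2 by simp
  finally have "s * s + 2 \<le> k" using of_nat_le_iff[where ?'a = real, of "s * s + 2" k] by simp
  hence "2 ^ (s - 1) \<le> card (trees k)" by (rule card_trees_ge)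
  hence many: "real (2 ^ (s - 1)) \<le> real (card (trees k))" by (simp only: of_nat_le_iff)
  have "2 powr (sqrt (real k - 2) - 2) \<le> 2 powr real (s - 1)"
    using s(2) by (intro powr_mono) auto
  also have "\<dots> = real (2 ^ (s - 1))" by (simp add: powr_realpow)
  also note many
  finally show "2 powr (sqrt (real k - 2) - 2) \<le> real (card (trees k))" .
qed simp_all

lemma polynomial_over_root_exponential_tendsto_0:
  "(\<lambda>k. real k ^ N / 2 powr (sqrt (real k - 2) - 2)) \<longlonglongrightarrow> 0"
  by real_asymp

theorem theorem3:
  shows "(\<forall>k\<ge>4. tau k \<ge> enat (k div 2)) \<and>
    (\<forall>t. (\<lambda>k. real (card {T \<in> trees k. signature k t -` {signature k t T} \<inter> trees k = {T}})
               / real (card (trees k))) \<longlonglongrightarrow> 0)"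
proof (intro conjI allI impI)
  show "enat (k div 2) \<le> tau k" if "4 \<le> k" for k
    using that by (rule tau_ge)
  show "(\<lambda>k. real (card {T \<in> trees k. signature k t -` {signature k t T} \<inter> trees k = {T}})
      / real (card (trees k))) \<longlonglongrightarrow> 0" for t
  proof (rule tendsto_sandwich[OF _ _ tendsto_const
        polynomial_over_root_exponential_tendsto_0[of "(t + 1) * (t + 1) ^ t"]])
    show "\<forall>\<^sub>F k in sequentially.
        real (card {T \<in> trees k. signature k t -` {signature k t T} \<inter> trees k = {T}})
          / real (card (trees k))
        \<le> real k ^ ((t + 1) * (t + 1) ^ t) / 2 powr (sqrt (real k - 2) - 2)"
      using eventually_ge_at_top[of "t + 2"] by eventually_elim (rule unique_fraction_le)
  qed simp
qed

end
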